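(* Let $I\subset\mathbb R\setminus\{0\}$ be an open interval, $f:I\to\mathbb R$ smooth with $f'^2>1$ and $f''\neq0$ everywhere on $I$, and let $C_1\neq0$ be a real constant. Let $M$ be the rotational hypersurface $\Gamma^t(s,t,w)=(f(s),\ -s\cos t\sin w,\ -s\sin t,\ s\cos t\cos w)$ in $\mathbb E_1^4$ with Gauss map $N^t=\frac1{\sqrt{f'^2-1}}(1,\ -f'\cos t\sin w,\ -f'\sin t,\ f'\cos t\cos w)$, and assume $L_2N^t$ is not identically zero. If the differential equation $$\left(1+C_1\sqrt{f'^2-1}\right)\Big(2\big(f'(f'^2-1)^2-s(2f'^2+1)f''\big)f''+s(f'^2-1)f'f'''\Big)-sf'^2\Big((f'^2-1)f'f'''-3(f'^2+1)f''^2\Big)=0$$ holds on $I$, then $M$ has second kind $L_2$-pointwise 1-type Gauss map; namely $L_2N^t=\mathfrak m(N^t+C)$ for some non-zero smooth function $\mathfrak m$, with $C=(C_1,0,0,0)$.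
   Context: $\mathbb E_1^4$ is $\mathbb R^4$ with the Lorentzian metric $\langle\,,\rangle=-dx_1^2+dx_2^2+dx_3^2+dx_4^2$. Let $M$ be an oriented hypersurface of $\mathbb E_1^4$ with nondegenerate induced metric $g$, unit normal vector field (Gauss map) $N$, $\varepsilon=\langle N,N\rangle=\pm1$, shape operator $S=-dN$ and principal curvatures $\kappa_1,\kappa_2,\kappa_3$. Put $a_0=1$, $a_1=-(\kappa_1+\kappa_2+\kappa_3)$, $a_2=\kappa_1\kappa_2+\kappa_1\kappa_3+\kappa_2\kappa_3$, $a_3=-\kappa_1\kappa_2\kappa_3$. The Newton transformations are $P_0=I$, $P_k=a_kI+S\circ P_{k-1}$, and $L_k(\varphi)=\mathrm{tr}(P_k\circ\nabla^2\varphi)$ for $\varphi\in C^\infty(M)$, where $\nabla^2\varphi$ is the Hessian operator of $\varphi$ with respect to $g$; $L_k$ acts componentwise on $\mathbb R^4$-valued functions such as $N$. With $n=3$, $\binom{n}{k}H_k=(-\varepsilon)^ka_k$ and $C_k=\binom{n}{k+1}(-\varepsilon)^k$, the known formula used for the Gauss map is $L_kN=-\varepsilon C_k\big(\nabla H_{k+1}+(nH_1H_{k+1}-(n-k-1)H_{k+2})N\big)$, where $\nabla$ is the gradient of $g$ (for $k=2$ the last term has coefficient $0$). $M$ has second kind $L_k$-pointwise 1-type Gauss map if $L_kN=\mathfrak m(N+C)$ for a non-zero (i.e. not identically zero) smooth function $\mathfrak m$ on $M$ and a non-zero constant vector $C\in\mathbb E_1^4$. Primes denote $d/ds$; $s\in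 I$, $0\le t,w\le2\pi$, and the parametrization is considered where it is an immersion ($\cos t\neq0$). *)

theory Defs
  imports "HOL-Analysis.Analysis"
begin

section \<open>Smooth functions on open sets\<close>

text \<open>\<open>Ck_on k U F\<close> is the class \<open>C\<^sup>k\<close> on an open set \<open>U\<close>, by iterated partial derivatives;
  for \<open>'a = real\<close> the only partial derivative is the ordinary derivative.\<close>

primrec Ck_on :: "nat \<Rightarrow> 'a::euclidean_space set \<Rightarrow> ('a \<Rightarrow> 'b::real_normed_vector) \<Rightarrow> bool" where
  "Ck_on 0 U F \<longleftrightarrow> continuous_on U F"
| "Ck_on (Suc k) U F \<longleftrightarrow> (\<forall>x\<in>U. F differentiable (at x)) \<and>
     (\<forall>b\<in>Basis. Ck_on k U (\<lambda>x. frechet_derivative F (at x) b))"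

definition smooth_on :: "'a::euclidean_space set \<Rightarrow> ('a \<Rightarrow> 'b::real_normed_vector) \<Rightarrow> bool" where
  "smooth_on U F \<longleftrightarrow> (\<forall>k. Ck_on k U F)"

definition partial :: "3 \<Rightarrow> (real^3 \<Rightarrow> 'b::real_normed_vector) \<Rightarrow> real^3 \<Rightarrow> 'b" where
  "partial i F p = frechet_derivative F (at p) (axis i 1)"


section \<open>Semi-Riemannian operators in a coordinate domain of \<open>\<real>\<^sup>3\<close>\<close>

text \<open>A metric is given by its matrix field \<open>g\<close>. Tangent vectors are coordinate vectors with respect to
  the coordinate frame, and endomorphisms of tangent spaces are matrices acting by \<open>(*v)\<close>.\<close>

definition christoffel :: "(real^3 \<Rightarrow> real^3^3) \<Rightarrow> 3 \<Rightarrow> 3 \<Rightarrow> 3 \<Rightarrow> real^3 \<Rightarrow> real" where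
  "christoffel g i j k p =
     (\<Sum>l\<in>UNIV. matrix_inv (g p) $ i $ l *
        (partial j (\<lambda>q. g q $ k $ l) p + partial k (\<lambda>q. g q $ j $ l) p
          - partial l (\<lambda>q. g q $ j $ k) p)) / 2"

definition gradient :: "(real^3 \<Rightarrow> real^3^3) \<Rightarrow> (real^3 \<Rightarrow> real) \<Rightarrow> real^3 \<Rightarrow> real^3" where
  "gradient g \<phi> p = matrix_inv (g p) *v (\<chi> j. partial j \<phi> p)"

text \<open>\<open>covariant_derivative g V p\<close> is the endomorphism \<open>X \<mapsto> \<nabla>\<^sub>X V\<close> for the Levi-Civita connection of \<open>g\<close>.\<close>

definition covariant_derivative ::
  "(real^3 \<Rightarrow> real^3^3) \<Rightarrow> (real^3 \<Rightarrow> real^3) \<Rightarrow> real^3 \<Rightarrow> real^3^3" where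
  "covariant_derivative g V p =
     (\<chi> i j. partial j (\<lambda>q. V q $ i) p + (\<Sum>l\<in>UNIV. christoffel g i j l p * V p $ l))"

definition hessian_operator :: "(real^3 \<Rightarrow> real^3^3) \<Rightarrow> (real^3 \<Rightarrow> real) \<Rightarrow> real^3 \<Rightarrow> real^3^3" where
  "hessian_operator g \<phi> = covariant_derivative g (gradient g \<phi>)"


section \<open>Hypersurfaces of \<open>\<real>\<^sup>4\<close> with the Lorentzian metric\<close>

definition lorentz :: "real^4 \<Rightarrow> real^4 \<Rightarrow> real" where
  "lorentz x y = - (x$1 * y$1) + x$2 * y$2 + x$3 * y$3 + x$4 * y$4"

text \<open>A hypersurface is given by an immersion \<open>X\<close> of an open parameter domain together with its Gauss
  map \<open>N\<close>, both as functions of the parameters.\<close>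

definition induced_metric :: "(real^3 \<Rightarrow> real^4) \<Rightarrow> real^3 \<Rightarrow> real^3^3" where
  "induced_metric X p = (\<chi> i j. lorentz (partial i X p) (partial j X p))"

text \<open>The matrix \<open>S\<close> with \<open>dX \<circ> S = - dN\<close>; it is unique since \<open>dX\<close> is injective.\<close>

definition shape_operator :: "(real^3 \<Rightarrow> real^4) \<Rightarrow> (real^3 \<Rightarrow> real^4) \<Rightarrow> real^3 \<Rightarrow> real^3^3" where
  "shape_operator X N p =
     (THE S. \<forall>v. frechet_derivative X (at p) (S *v v) = - frechet_derivative N (at p) v)"

text \<open>The eigenvalues listed with algebraic multiplicity, i.e. the roots of the characteristic
  polynomial. Only symmetric functions of them are used below, so their order is irrelevant.\<close>

definition principal_curvatures :: "real^3^3 \<Rightarrow> real^3" where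
  "principal_curvatures S = (SOME \<kappa>. \<forall>x. det (mat x - S) = (\<Prod>i\<in>UNIV. x - \<kappa> $ i))"

definition newton_coeff :: "nat \<Rightarrow> real^3^3 \<Rightarrow> real" where
  "newton_coeff k S = (let \<kappa> = principal_curvatures S in
     if k = 0 then 1
     else if k = 1 then - (\<kappa>$1 + \<kappa>$2 + \<kappa>$3)
     else if k = 2 then \<kappa>$1 * \<kappa>$2 + \<kappa>$1 * \<kappa>$3 + \<kappa>$2 * \<kappa>$3
     else if k = 3 then - (\<kappa>$1 * \<kappa>$2 * \<kappa>$3)
     else 0)"

primrec newton_transformation :: "nat \<Rightarrow> real^3^3 \<Rightarrow> real^3^3" where
  "newton_transformation 0 S = mat 1"
| "newton_transformation (Suc k) S =
     newton_coeff (Suc k) S *\<^sub>R mat 1 + S ** newton_transformation k S"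

definition L_op ::
  "nat \<Rightarrow> (real^3 \<Rightarrow> real^4) \<Rightarrow> (real^3 \<Rightarrow> real^4) \<Rightarrow> (real^3 \<Rightarrow> real) \<Rightarrow> real^3 \<Rightarrow> real" where
  "L_op k X N \<phi> p =
     trace (newton_transformation k (shape_operator X N p)
              ** hessian_operator (induced_metric X) \<phi> p)"

definition L_vec ::
  "nat \<Rightarrow> (real^3 \<Rightarrow> real^4) \<Rightarrow> (real^3 \<Rightarrow> real^4) \<Rightarrow> (real^3 \<Rightarrow> real^4) \<Rightarrow> real^3 \<Rightarrow> real^4" where
  "L_vec k X N F p = (\<chi> a. L_op k X N (\<lambda>q. F q $ a) p)"

text \<open>\<open>m\<close> is a function on the point set \<open>X ` U\<close>; its values elsewhere are irrelevant. It is smooth on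
  the hypersurface when it is smooth in the parameters.\<close>

definition second_kind_L_pointwise_1_type_with ::
  "nat \<Rightarrow> (real^3) set \<Rightarrow> (real^3 \<Rightarrow> real^4) \<Rightarrow> (real^3 \<Rightarrow> real^4) \<Rightarrow> real^4 \<Rightarrow> bool" where
  "second_kind_L_pointwise_1_type_with k U X N C \<longleftrightarrow>
     C \<noteq> 0 \<and>
     (\<exists>m :: real^4 \<Rightarrow> real.
        smooth_on U (m \<circ> X) \<and> (\<exists>x \<in> X ` U. m x \<noteq> 0) \<and>
        (\<forall>p\<in>U. L_vec k X N N p = m (X p) *\<^sub>R (N p + C)))"

definition second_kind_L_pointwise_1_type ::
  "nat \<Rightarrow> (real^3) set \<Rightarrow> (real^3 \<Rightarrow> real^4) \<Rightarrow> (real^3 \<Rightarrow> real^4) \<Rightarrow> bool" where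
  "second_kind_L_pointwise_1_type k U X N \<longleftrightarrow>
     (\<exists>C. second_kind_L_pointwise_1_type_with k U X N C)"


section \<open>The rotational hypersurface\<close>

text \<open>The parameters are \<open>p = (s, t, w)\<close>.\<close>

definition rot_hypersurface :: "(real \<Rightarrow> real) \<Rightarrow> real^3 \<Rightarrow> real^4" where
  "rot_hypersurface f p = (let s = p$1; t = p$2; w = p$3 in
     vector [f s, - s * cos t * sin w, - s * sin t, s * cos t * cos w])"

definition rot_gauss_map :: "(real \<Rightarrow> real) \<Rightarrow> real^3 \<Rightarrow> real^4" where
  "rot_gauss_map f p = (let s = p$1; t = p$2; w = p$3; f' = deriv f s in
     (1 / sqrt (f'\<^sup>2 - 1)) *\<^sub>R
       vector [1, - f' * cos t * sin w, - f' * sin t, f' * cos t * cos w])"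

text \<open>The angles range over \<open>\<real>\<close>, so that the parameter domain is open. By periodicity nothing changes
  compared to angles in \<open>[0, 2\<pi>]\<close>.\<close>

definition rot_domain :: "real set \<Rightarrow> (real^3) set" where
  "rot_domain I = {p. p$1 \<in> I \<and> cos (p$2) \<noteq> 0}"

lemma rot_domain_closed_angles:
  assumes "p \<in> rot_domain I"
  obtains q where "q \<in> rot_domain I" "q$1 = p$1" "q$2 \<in> {0..2*pi}" "q$3 \<in> {0..2*pi}"
    "rot_hypersurface f q = rot_hypersurface f p" "rot_gauss_map f q = rot_gauss_map f p"
proof -
  have red: "\<exists>y\<in>{0..2*pi}. sin y = sin x \<and> cos y = cos x" for x :: real
    using sincos_total_2pi_le [of "cos x" "sin x"] by (metis atLeastAtMost_iff sin_cos_squared_add2)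
  obtain t where t: "t \<in> {0..2*pi}" "sin t = sin (p$2)" "cos t = cos (p$2)"
    using red by metis
  obtain w where w: "w \<in> {0..2*pi}" "sin w = sin (p$3)" "cos w = cos (p$3)"
    using red by metis
  define q :: "real^3" where "q = vector [p$1, t, w]"
  have "q$1 = p$1" "q$2 = t" "q$3 = w"
    by (simp_all add: q_def)
  with t w assms show ?thesis
    by (intro that [of q]) (simp_all add: rot_domain_def rot_hypersurface_def rot_gauss_map_def Let_def)
qed

end

theory Submission
  imports Defs
begin

text \<open>
  The coordinates \<open>(s, t, w)\<close> diagonalise both the induced metric and the shape operator, with
  principal curvatures \<open>k\<^sub>1 = f'' / W\<^sup>3\<close> and \<open>k\<^sub>2 = k\<^sub>3 = - f' / (s W)\<close>, where
  \<open>W\<^sup>2 = f'\<^sup>2 - 1\<close>. Hence \<open>L\<^sub>2 \<phi>\<close> only involves the diagonal of the Hessian operator,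
  weighted by \<open>k\<^sub>2\<^sup>2\<close>, \<open>k\<^sub>1 k\<^sub>2\<close> and \<open>k\<^sub>1 k\<^sub>2\<close>. Each component of the Gauss map is a product
  of a function of \<open>s\<close> with a spherical harmonic of degree at most one in \<open>(t, w)\<close>, so the angular part
  contributes a multiple of the component itself. The last three components of \<open>L\<^sub>2 N\<close> are thus
  \<open>\<mu>(s)\<close> times those of \<open>N\<close>, and the differential equation says exactly that the first component
  of \<open>L\<^sub>2 N\<close> is \<open>\<mu>(s)\<close> times \<open>N\<^sub>1 + C\<^sub>1\<close>. Finally, \<open>s\<close> is a function on the point set, because
  \<open>\<bar>s\<bar>\<close> is the distance from the axis and \<open>I\<close> lies on one side of \<open>0\<close>.
\<close>

section \<open>Calculus of smooth functions\<close>

lemma frechet_derivative_cong_open: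
  assumes "open U" "x \<in> U" "\<And>y. y \<in> U \<Longrightarrow> F y = G y"
  shows "frechet_derivative F (at x) = frechet_derivative G (at x)"
proof -
  have "(F has_derivative D) (at x) \<longleftrightarrow> (G has_derivative D) (at x)" for D
    using has_derivative_transform_within_open [OF _ assms(1,2)] assms(3) by metis
  then show ?thesis
    by (simp add: frechet_derivative_def)
qed

lemma partial_cong_open:
  assumes "open U" "p \<in> U" "\<And>q. q \<in> U \<Longrightarrow> F q = G q"
  shows "partial i F p = partial i G p"
  unfolding partial_def using frechet_derivative_cong_open [OF assms] by simp

text \<open>Frechet derivatives at points of an open set see only the values on that set, so
  induction on \<open>k\<close> passes the equality from \<open>F\<close> and \<open>G\<close> to
  their partial derivatives. This is what permits replacing \<open>frechet_derivative\<close> by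
  closed formulas valid only on \<open>U\<close>.\<close>

lemma Ck_on_cong:
  assumes "open U" "\<And>x. x \<in> U \<Longrightarrow> F x = G x" "Ck_on k U F"
  shows "Ck_on k U G"
  using assms(2,3)
proof (induction k arbitrary: F G)
  case 0
  then show ?case by (simp cong: continuous_on_cong)
next
  case (Suc k)
  have "G differentiable at x" if "x \<in> U" for x
    using Suc.prems that has_derivative_transform_within_open [OF _ assms(1) that]
    unfolding differentiable_def Ck_on.simps by metis
  moreover have "Ck_on k U (\<lambda>x. frechet_derivative G (at x) b)" if "b \<in> Basis" for b
  proof (rule Suc.IH)
    show "frechet_derivative F (at x) b = frechet_derivative G (at x) b" if "x \<in> U" for x
      using frechet_derivative_cong_open [OF assms(1) that Suc.prems(1)] by simp
    show "Ck_on k U (\<lambda>x. frechet_derivative F (at x) b)"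
      using Suc.prems(2) that by simp
  qed
  ultimately show ?case by simp
qed

lemma Ck_on_SucD:
  assumes "Ck_on (Suc k) U F"
  shows "Ck_on k U F"
  using assms
proof (induction k arbitrary: F)
  case 0
  then show ?case
    by (metis Ck_on.simps differentiable_at_withinI differentiable_imp_continuous_on
        differentiable_on_def)
next
  case (Suc k)
  then show ?case by (metis Ck_on.simps(2))
qed

lemma Ck_on_SucI:
  assumes "open U" "\<And>x. x \<in> U \<Longrightarrow> (F has_derivative F' x) (at x)"
    and "\<And>b. b \<in> Basis \<Longrightarrow> Ck_on k U (\<lambda>x. F' x b)"
  shows "Ck_on (Suc k) U F"
proof -
  have "Ck_on k U (\<lambda>x. frechet_derivative F (at x) b)" if "b \<in> Basis" for b
    using assms(2) by (intro Ck_on_cong [OF assms(1) _ assms(3) [OF that]]) (metis frechet_derivative_at)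
  then show ?thesis
    using assms(2) by (auto simp: differentiable_def)
qed

lemma Ck_on_derivativeD:
  assumes "Ck_on (Suc k) U F"
  shows "x \<in> U \<Longrightarrow> (F has_derivative frechet_derivative F (at x)) (at x)"
    and "b \<in> Basis \<Longrightarrow> Ck_on k U (\<lambda>x. frechet_derivative F (at x) b)"
  using assms by (auto simp: frechet_derivative_works)

section \<open>Closure of C^k under arithmetic and under composition with a coordinate\<close>

lemma Ck_on_const: "open U \<Longrightarrow> Ck_on k U (\<lambda>x. c)"
proof (induction k arbitrary: c)
  case (Suc k)
  then show ?case by (intro Ck_on_SucI [where F' = "\<lambda>_ _. 0"]) auto
qed simp

lemma Ck_on_add:
  assumes "open U" "Ck_on k U F" "Ck_on k U G"
  shows "Ck_on k U (\<lambda>x. F x + G x)"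
  using assms(2,3)
proof (induction k arbitrary: F G)
  case (Suc k)
  note F = Ck_on_derivativeD [OF Suc.prems(1)] and G = Ck_on_derivativeD [OF Suc.prems(2)]
  show ?case
    by (rule Ck_on_SucI [OF assms(1) has_derivative_add [OF F(1) G(1)]], assumption+)
      (intro Suc.IH F(2) G(2); assumption)
qed (simp add: continuous_on_add)

lemma Ck_on_mult:
  fixes F G :: "'a::euclidean_space \<Rightarrow> real"
  assumes "open U" "Ck_on k U F" "Ck_on k U G"
  shows "Ck_on k U (\<lambda>x. F x * G x)"
  using assms(2,3)
proof (induction k arbitrary: F G)
  case (Suc k)
  note F = Ck_on_derivativeD [OF Suc.prems(1)] and G = Ck_on_derivativeD [OF Suc.prems(2)]
  show ?case
    by (rule Ck_on_SucI [OF assms(1) has_derivative_mult [OF F(1) G(1)]], assumption+)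
      \<comment> \<open>Each term of the product rule keeps one factor undifferentiated; that factor
        is of class C^(k+1) and is lowered to C^k before the induction hypothesis applies.\<close>
      (intro Ck_on_add assms(1) Suc.IH F(2) G(2) Suc.prems [THEN Ck_on_SucD]; assumption)
qed (simp add: continuous_on_mult)

lemma Ck_on_diff:
  fixes F G :: "'a::euclidean_space \<Rightarrow> real"
  assumes "open U" "Ck_on k U F" "Ck_on k U G"
  shows "Ck_on k U (\<lambda>x. F x - G x)"
  using Ck_on_add [OF assms(1,2) Ck_on_mult [OF assms(1) Ck_on_const [OF assms(1), of k "- 1"] assms(3)]]
  by simp

lemma Ck_on_power:
  fixes F :: "'a::euclidean_space \<Rightarrow> real"
  assumes "open U" "Ck_on k U F"
  shows "Ck_on k U (\<lambda>x. F x ^ n)"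
  by (induction n) (auto intro: Ck_on_const Ck_on_mult assms)

text \<open>The derivative of \<open>1/F\<close> is \<open>-(1/F) F' (1/F)\<close>, which involves
  \<open>1/F\<close> only to the order \<open>k\<close> already known, so the product rule closes
  the induction.\<close>

lemma Ck_on_inverse:
  fixes F :: "'a::euclidean_space \<Rightarrow> real"
  assumes "open U" "Ck_on k U F" "\<And>x. x \<in> U \<Longrightarrow> F x \<noteq> 0"
  shows "Ck_on k U (\<lambda>x. inverse (F x))"
  using assms(2)
proof (induction k)
  case (Suc k)
  note F = Ck_on_derivativeD [OF Suc.prems]
  have inv: "Ck_on k U (\<lambda>x. inverse (F x))"
    using Suc.IH Suc.prems [THEN Ck_on_SucD] by blast
  show ?case
  proof (rule Ck_on_SucI [OF assms(1) Deriv.has_derivative_inverse [OF assms(3) F(1)]])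
    fix b :: 'a assume b: "b \<in> Basis"
    have "Ck_on k U (\<lambda>x. (- 1) * (inverse (F x) * frechet_derivative F (at x) b * inverse (F x)))"
      by (intro Ck_on_mult Ck_on_const assms(1) inv F(2) [OF b])
    then show "Ck_on k U (\<lambda>x. - (inverse (F x) * frechet_derivative F (at x) b * inverse (F x)))"
      by simp
  qed
qed (use assms(3) in \<open>auto intro: continuous_on_inverse\<close>)

text \<open>By the chain rule a partial derivative of \<open>h (p $ i)\<close> is a constant times
  \<open>h' (p $ i)\<close>, a function of the same form; hence the induction generalises over
  \<open>h\<close>.\<close>

lemma Ck_on_compose_nth:
  fixes h :: "real \<Rightarrow> real"
  assumes "open U" "\<And>p. p \<in> U \<Longrightarrow> p $ i \<in> I" "Ck_on k I h"
  shows "Ck_on k U (\<lambda>p :: real^'n. h (p $ i))"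
  using assms(3)
proof (induction k arbitrary: h)
  case 0
  then show ?case
    using assms(2) by (auto intro!: continuous_on_compose2 [of I h] continuous_intros)
next
  case (Suc k)
  note h = Ck_on_derivativeD [OF Suc.prems]
  have "((\<lambda>p. h (p $ i)) has_derivative (\<lambda>v. v $ i * frechet_derivative h (at (p $ i)) 1)) (at p)"
    if "p \<in> U" for p
  proof (rule DERIV_compose_FDERIV [of h])
    have "(h has_derivative frechet_derivative h (at (p $ i))) (at (p $ i))"
      using h(1) assms(2) that by blast
    \<comment> \<open>A linear map on the reals is multiplication by its value at 1, which turns the
      Frechet derivative into an ordinary one.\<close>
    moreover have "frechet_derivative h (at (p $ i)) x = frechet_derivative h (at (p $ i)) 1 * x" for x
      using linear_scale [of "frechet_derivative h (at (p $ i))" x 1]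
        calculation has_derivative_linear by fastforce
    ultimately show "(h has_real_derivative frechet_derivative h (at (p $ i)) 1) (at (p $ i))"
      unfolding has_field_derivative_def by (metis ext)
    show "((\<lambda>p. p $ i) has_derivative (\<lambda>v. v $ i)) (at p)"
      by (rule bounded_linear_imp_has_derivative [OF bounded_linear_vec_nth])
  qed
  then show ?case
  proof (rule Ck_on_SucI [OF assms(1)])
    fix b :: "real^'n" assume "b \<in> Basis"
    show "Ck_on k U (\<lambda>p. b $ i * frechet_derivative h (at (p $ i)) 1)"
      by (intro Ck_on_mult Ck_on_const assms(1) Suc.IH h(2)) auto
  qed
qed

section \<open>Smooth functions of one variable in terms of \<open>deriv\<close>\<close>

lemma Ck_on_real_SucD:
  fixes h :: "real \<Rightarrow> real"
  assumes "open I" "Ck_on (Suc k) I h"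
  shows "\<And>x. x \<in> I \<Longrightarrow> (h has_real_derivative deriv h x) (at x)" and "Ck_on k I (deriv h)"
proof -
  note h = Ck_on_derivativeD [OF assms(2)]
  show D: "(h has_real_derivative deriv h x) (at x)" if "x \<in> I" for x
    using h(1) [OF that] unfolding DERIV_deriv_iff_real_differentiable differentiable_def by blast
  show "Ck_on k I (deriv h)"
  proof (rule Ck_on_cong [OF assms(1)])
    show "Ck_on k I (\<lambda>x. frechet_derivative h (at x) 1)"
      by (rule h(2)) simp
    show "frechet_derivative h (at x) 1 = deriv h x" if "x \<in> I" for x
      using D [OF that] frechet_derivative_at unfolding has_field_derivative_def
      by (metis mult.right_neutral)
  qed
qed

lemma Ck_on_ident: "open I \<Longrightarrow> Ck_on k I (\<lambda>x::real. x)"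
  by (cases k) (auto intro!: Ck_on_SucI [where F' = "\<lambda>_ v. v"] Ck_on_const)

lemma smooth_on_deriv:
  fixes h :: "real \<Rightarrow> real"
  assumes "open I" "smooth_on I h"
  shows "smooth_on I (deriv h)"
  using assms Ck_on_real_SucD(2) unfolding smooth_on_def by blast

lemma smooth_on_funpow_deriv:
  fixes h :: "real \<Rightarrow> real"
  assumes "open I" "smooth_on I h"
  shows "smooth_on I ((deriv ^^ n) h)"
  by (induction n) (auto simp: assms smooth_on_deriv)

lemma smooth_on_real_DERIV:
  fixes h :: "real \<Rightarrow> real"
  assumes "open I" "smooth_on I h" "x \<in> I"
  shows "(h has_real_derivative deriv h x) (at x)"
  using Ck_on_real_SucD(1) [OF assms(1) _ assms(3)] assms(2) unfolding smooth_on_def by blast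


section \<open>Diagonal metrics and diagonal shape operators\<close>

definition diag :: "real^'n \<Rightarrow> real^'n^'n" where
  "diag d = (\<chi> i j. if i = j then d $ i else 0)"

lemma diag_nth: "diag d $ i $ j = (if i = j then d $ i else 0)"
  by (simp add: diag_def)

lemma diag_mult_vec: "diag d *v x = (\<chi> i. d $ i * x $ i)"
  by (simp add: diag_def matrix_vector_mult_def mult_delta_left sum.delta)

lemma diag_mult_diag: "diag a ** diag b = diag (\<chi> i. a $ i * b $ i)"
  by (simp add: vec_eq_iff diag_def matrix_matrix_mult_def mult_delta_left mult_delta_right sum.delta)

lemma trace_diag_mult: "trace (diag d ** H) = (\<Sum>i\<in>UNIV. d $ i * H $ i $ i)"
  by (simp add: trace_def diag_def matrix_matrix_mult_def mult_delta_left sum.delta)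

lemma matrix_inv_diag:
  assumes "\<And>i. d $ i \<noteq> 0"
  shows "matrix_inv (diag d) = diag (\<chi> i. 1 / d $ i)"
proof -
  let ?B = "diag (\<chi> i. 1 / d $ i)"
  have "diag (\<chi> i. 1) = (mat 1 :: real^'n^'n)"
    by (simp add: vec_eq_iff diag_def mat_def)
  then have B: "diag d ** ?B = mat 1" "?B ** diag d = mat 1"
    using assms by (simp_all add: diag_mult_diag)
  \<comment> \<open>\<open>matrix_inv\<close> is a choice among two-sided inverses. The explicit
    \<open>?B\<close> shows that one exists, and multiplying by \<open>?B\<close> from the left
    identifies the chosen one.\<close>
  have "diag d ** matrix_inv (diag d) = mat 1"
    unfolding matrix_inv_def by (rule someI2 [of _ ?B]) (use B in auto)
  then have "?B ** (diag d ** matrix_inv (diag d)) = ?B"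
    by simp
  then show ?thesis
    by (simp add: matrix_mul_assoc B)
qed

section \<open>Newton transformation and Hessian operator in the diagonal case\<close>

lemma prod_UNIV_3: "(\<Prod>i\<in>UNIV. h (i::3)) = h 1 * h 2 * (h 3 :: 'a::comm_monoid_mult)"
  unfolding UNIV_3 by (simp add: ac_simps)

text \<open>The choice operator may list the eigenvalues in any order, so only their symmetric
  functions can be determined. Both lists give the same monic cubic, and its values at 0, 1 and -1
  fix the three remaining coefficients.\<close>

lemma principal_curvatures_diag:
  fixes d :: "real^3"
  defines "k \<equiv> principal_curvatures (diag d)"
  shows "k$1 + k$2 + k$3 = d$1 + d$2 + d$3"
    and "k$1 * k$2 + k$1 * k$3 + k$2 * k$3 = d$1 * d$2 + d$1 * d$3 + d$2 * d$3"
    and "k$1 * k$2 * k$3 = d$1 * d$2 * d$3"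
proof -
  have det: "det (mat x - diag d) = (\<Prod>i\<in>UNIV. x - d $ i)" for x
    using det_diagonal [of "mat x - diag d"] by (simp add: mat_def diag_def)
  have "\<forall>x. det (mat x - diag d) = (\<Prod>i\<in>UNIV. x - k $ i)"
    unfolding k_def principal_curvatures_def by (rule someI [of _ d]) (simp add: det)
  then have eq: "(x - d$1) * (x - d$2) * (x - d$3) = (x - k$1) * (x - k$2) * (x - k$3)" for x
    by (simp add: det prod_UNIV_3)
  show "k$1 * k$2 * k$3 = d$1 * d$2 * d$3"
    using eq [of 0] by simp
  with eq [of 1] eq [of "- 1"] show
    "k$1 + k$2 + k$3 = d$1 + d$2 + d$3"
    "k$1 * k$2 + k$1 * k$3 + k$2 * k$3 = d$1 * d$2 + d$1 * d$3 + d$2 * d$3"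
    by (simp_all add: algebra_simps)
qed

text \<open>With \<open>e1\<close> and \<open>e2\<close> the first two elementary symmetric
  functions of \<open>d\<close>, the diagonal entries are \<open>e2 - e1 * d$i + (d$i)^2\<close>,
  the product of the two other entries of \<open>d\<close>.\<close>

lemma newton_transformation_2_diag:
  "newton_transformation 2 (diag d) = diag (vector [d$2 * d$3, d$1 * d$3, d$1 * d$2])"
proof -
  have c: "newton_coeff (Suc 0) (diag d) = - (d$1 + d$2 + d$3)"
    "newton_coeff (Suc (Suc 0)) (diag d) = d$1 * d$2 + d$1 * d$3 + d$2 * d$3"
    using principal_curvatures_diag [of d] by (simp_all add: newton_coeff_def Let_def)
  show ?thesis
    unfolding numeral_2_eq_2 newton_transformation.simps c
    by (auto simp: vec_eq_iff forall_3 diag_def matrix_matrix_mult_def sum_3 mat_def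
        algebra_simps)
qed

text \<open>Diagonal entries suffice, since \<open>L_op\<close> takes the trace against a matrix
  that will be diagonal. An open \<open>U\<close> around \<open>p\<close> is assumed because the
  Christoffel symbols and the second derivatives use \<open>g\<close> near \<open>p\<close>.\<close>

lemma hessian_operator_diag:
  fixes \<gamma> :: "real^3 \<Rightarrow> real^3"
  assumes "open U" "p \<in> U" and g: "\<And>q. q \<in> U \<Longrightarrow> g q = diag (\<gamma> q)"
    and nz: "\<And>q i. q \<in> U \<Longrightarrow> \<gamma> q $ i \<noteq> 0"
  shows "hessian_operator g \<phi> p $ i $ i =
    partial i (\<lambda>q. partial i \<phi> q / \<gamma> q $ i) p +
    (\<Sum>l\<in>UNIV. partial l (\<lambda>q. \<gamma> q $ i) p / (2 * \<gamma> p $ i) * (partial l \<phi> p / \<gamma> p $ l))"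
proof -
  have grad: "gradient g \<phi> q $ l = partial l \<phi> q / \<gamma> q $ l" if "q \<in> U" for q l
    by (simp add: gradient_def g that matrix_inv_diag nz diag_mult_vec)
  have "partial j (\<lambda>q. g q $ k $ l) p = partial j (\<lambda>q. diag (\<gamma> q) $ k $ l) p" for j k l
    by (rule partial_cong_open [OF assms(1,2)]) (simp add: g)
  \<comment> \<open>Symmetry cancels the first and third terms of the Christoffel symbol with upper
    index \<open>i\<close> and lower indices \<open>i\<close>, \<open>l\<close>, so only the
    derivative of the i-th metric coefficient in direction \<open>l\<close> survives.\<close>
  moreover have "diag (\<gamma> q) $ i $ l = diag (\<gamma> q) $ l $ i" for q l
    by (simp add: diag_def)
  ultimately have "christoffel g i i l p = partial l (\<lambda>q. \<gamma> q $ i) p / (2 * \<gamma> p $ i)" for l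
    unfolding christoffel_def
    by (simp add: g assms(2) matrix_inv_diag nz diag_nth mult_delta_left sum.delta)
  moreover have "partial i (\<lambda>q. gradient g \<phi> q $ i) p = partial i (\<lambda>q. partial i \<phi> q / \<gamma> q $ i) p"
    by (rule partial_cong_open [OF assms(1,2)]) (simp add: grad)
  ultimately show ?thesis
    by (simp add: hessian_operator_def covariant_derivative_def grad assms(2))
qed


section \<open>Functions with separated variables\<close>

text \<open>The components of the immersion and of the Gauss map and the metric coefficients all
  have this form, which reduces every partial derivative to a derivative in one variable.\<close>

definition separated :: "(real \<Rightarrow> real) \<Rightarrow> (real \<Rightarrow> real) \<Rightarrow> (real \<Rightarrow> real) \<Rightarrow> real^3 \<Rightarrow> real" where
  "separated A B D p = A (p$1) * B (p$2) * D (p$3)"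

lemma has_derivative_separated:
  assumes "(A has_real_derivative a) (at (p$1))" "(B has_real_derivative b) (at (p$2))"
    "(D has_real_derivative d) (at (p$3))"
  shows "(separated A B D has_derivative
    (\<lambda>v. a * B (p$2) * D (p$3) * v$1 + A (p$1) * b * D (p$3) * v$2 + A (p$1) * B (p$2) * d * v$3)) (at p)"
proof -
  have nth: "((\<lambda>p :: real^3. p $ i) has_derivative (\<lambda>v. v $ i)) (at p)" for i
    by (rule bounded_linear_imp_has_derivative [OF bounded_linear_vec_nth])
  note DERIV_compose_FDERIV [OF assms(1) nth] DERIV_compose_FDERIV [OF assms(2) nth]
    DERIV_compose_FDERIV [OF assms(3) nth]
  from has_derivative_mult [OF has_derivative_mult [OF this(1,2)] this(3)]
  show ?thesis
    unfolding separated_def by (rule has_derivative_eq_rhs) (simp add: fun_eq_iff algebra_simps)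
qed

lemma partial_separated:
  assumes "(A has_real_derivative a) (at (p$1))" "(B has_real_derivative b) (at (p$2))"
    "(D has_real_derivative d) (at (p$3))"
  shows "partial 1 (separated A B D) p = a * B (p$2) * D (p$3)"
    and "partial 2 (separated A B D) p = A (p$1) * b * D (p$3)"
    and "partial 3 (separated A B D) p = A (p$1) * B (p$2) * d"
  unfolding partial_def frechet_derivative_at [OF has_derivative_separated [OF assms], symmetric]
  by (simp_all add: axis_def)

lemma has_derivative_vec_nth:
  fixes F :: "'a::real_normed_vector \<Rightarrow> real^'n"
  assumes "\<And>i. ((\<lambda>x. F x $ i) has_derivative (\<lambda>v. F' v $ i)) (at p)"
  shows "(F has_derivative F') (at p)"
  unfolding has_derivative_componentwise_within [of F]
  using assms by (auto simp: Basis_vec_def inner_axis)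

lemma vector_4:
  "(vector [x, y, z, u] :: 'a::zero^4) $ 1 = x" "(vector [x, y, z, u] :: 'a^4) $ 2 = y"
  "(vector [x, y, z, u] :: 'a^4) $ 3 = z" "(vector [x, y, z, u] :: 'a^4) $ 4 = u"
  by (simp_all add: vector_def)


section \<open>Geometry of the rotational hypersurface\<close>

definition latitude :: "4 \<Rightarrow> real \<Rightarrow> real" where
  "latitude a t = (if a = 1 then 1 else if a = 2 then - cos t else if a = 3 then - sin t else cos t)"

definition latitude' :: "4 \<Rightarrow> real \<Rightarrow> real" where
  "latitude' a t = (if a = 1 then 0 else if a = 2 then sin t else if a = 3 then - cos t else - sin t)"

definition longitude :: "4 \<Rightarrow> real \<Rightarrow> real" where
  "longitude a w = (if a = 1 \<or> a = 3 then 1 else if a = 2 then sin w else cos w)"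

definition longitude' :: "4 \<Rightarrow> real \<Rightarrow> real" where
  "longitude' a w = (if a = 1 \<or> a = 3 then 0 else if a = 2 then cos w else - sin w)"

lemma DERIV_latitude:
  "(latitude a has_real_derivative latitude' a t) (at t)"
  "(latitude' a has_real_derivative (if a = 1 then 0 else - latitude a t)) (at t)"
  using exhaust_4 [of a]
  by (auto simp: latitude_def [abs_def] latitude'_def [abs_def] intro!: derivative_eq_intros)

lemma DERIV_longitude:
  "(longitude a has_real_derivative longitude' a w) (at w)"
  "(longitude' a has_real_derivative (if a = 1 \<or> a = 3 then 0 else - longitude a w)) (at w)"
  using exhaust_4 [of a]
  by (auto simp: longitude_def [abs_def] longitude'_def [abs_def] intro!: derivative_eq_intros)

text \<open>The left side is the Laplacian of the unit 2-sphere with metric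
  \<open>dt^2 + (cos t)^2 dw^2\<close>, applied to the angular factor. Component 1 is constant, with
  eigenvalue 0; the others are, up to sign, the Euclidean coordinates of the sphere, with eigenvalue
  -2.\<close>

lemma latitude_longitude_laplacian:
  assumes "cos t \<noteq> 0"
  shows "(if a = 1 then 0 else - latitude a t) * longitude a w
      + latitude a t * (if a = 1 \<or> a = 3 then 0 else - longitude a w) / (cos t)\<^sup>2
      - sin t / cos t * latitude' a t * longitude a w
    = (if a = 1 then 0 else - 2 * latitude a t * longitude a w)"
proof -
  have sin_sin: "sin t * sin t = 1 - cos t * cos t"
    using sin_squared_eq [of t] by (simp add: power2_eq_square)
  then have sin_sin': "sin t * (sin t * x) = x - cos t * (cos t * x)" for x
    by (metis left_diff_distrib mult.assoc mult_1)
  show ?thesis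
    using exhaust_4 [of a] assms
    by (auto simp: sin_sin sin_sin' latitude_def latitude'_def longitude_def field_simps power2_eq_square)
qed

text \<open>The bound on \<open>deriv f\<close> makes the normal spacelike, with
  \<open>lorentz N N = 1\<close>, and the profile direction timelike, since its metric coefficient
  is \<open>1 - f'^2\<close>.\<close>

locale rotational_profile =
  fixes I :: "real set" and f :: "real \<Rightarrow> real"
  assumes open_I: "open I" and zero_notin: "0 \<notin> I" and smooth: "smooth_on I f"
    and spacelike_normal: "\<And>s. s \<in> I \<Longrightarrow> (deriv f s)\<^sup>2 > 1"
begin

abbreviation f1 where "f1 \<equiv> deriv f"
abbreviation f2 where "f2 \<equiv> (deriv ^^ 2) f"
abbreviation f3 where "f3 \<equiv> (deriv ^^ 3) f"
abbreviation "U \<equiv> rot_domain I"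
abbreviation "X \<equiv> rot_hypersurface f"
abbreviation "N \<equiv> rot_gauss_map f"

section \<open>Radial functions of the profile curve and their derivatives\<close>

definition W :: "real \<Rightarrow> real" where
  "W s = sqrt ((f1 s)\<^sup>2 - 1)"

definition radial_X :: "4 \<Rightarrow> real \<Rightarrow> real" where
  "radial_X a s = (if a = 1 then f s else s)"

definition radial_N :: "4 \<Rightarrow> real \<Rightarrow> real" where
  "radial_N a s = (if a = 1 then 1 / W s else f1 s / W s)"

definition radial_N' :: "4 \<Rightarrow> real \<Rightarrow> real" where
  "radial_N' a s = (if a = 1 then - f1 s * f2 s / W s ^ 3 else - f2 s / W s ^ 3)"

definition radial_N'' :: "4 \<Rightarrow> real \<Rightarrow> real" where
  "radial_N'' a s =
    (if a = 1 then - ((f2 s)\<^sup>2 + f1 s * f3 s) / W s ^ 3 + 3 * (f1 s)\<^sup>2 * (f2 s)\<^sup>2 / W s ^ 5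
     else - f3 s / W s ^ 3 + 3 * f1 s * (f2 s)\<^sup>2 / W s ^ 5)"

definition k1 :: "real \<Rightarrow> real" where
  "k1 s = f2 s / W s ^ 3"

definition k2 :: "real \<Rightarrow> real" where
  "k2 s = - f1 s / (s * W s)"

definition metric :: "real^3 \<Rightarrow> real^3" where
  "metric p = vector [1 - (f1 (p$1))\<^sup>2, (p$1)\<^sup>2, (p$1)\<^sup>2 * (cos (p$2))\<^sup>2]"

lemma domainD:
  assumes "p \<in> U"
  shows "p$1 \<in> I" "p$1 \<noteq> 0" "cos (p$2) \<noteq> 0"
  using assms zero_notin by (auto simp: rot_domain_def)

lemma open_domain: "open U"
proof -
  have "U = (\<lambda>p. p$1) -` I \<inter> (\<lambda>p. cos (p$2)) -` (- {0})"
    by (auto simp: rot_domain_def)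
  moreover have "open ((\<lambda>p :: real^3. p$1) -` I)"
    by (rule open_vimage [OF open_I]) (intro continuous_intros)
  moreover have "open ((\<lambda>p :: real^3. cos (p$2)) -` (- {0}))"
    by (rule open_vimage) (auto intro!: continuous_intros)
  ultimately show ?thesis
    by auto
qed

lemma W_pos: "s \<in> I \<Longrightarrow> W s > 0"
  using spacelike_normal by (simp add: W_def)

lemma W_squared: "s \<in> I \<Longrightarrow> (W s)\<^sup>2 = (f1 s)\<^sup>2 - 1"
  using spacelike_normal [of s] by (simp add: W_def)

lemma f1_nonzero: "s \<in> I \<Longrightarrow> f1 s \<noteq> 0"
  using spacelike_normal [of s] by auto

lemma DERIV_f:
  assumes "s \<in> I"
  shows "(f has_real_derivative f1 s) (at s)" "(f1 has_real_derivative f2 s) (at s)"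
    "(f2 has_real_derivative f3 s) (at s)"
proof -
  have "((deriv ^^ n) f has_real_derivative (deriv ^^ Suc n) f s) (at s)" for n
    using smooth_on_real_DERIV [OF open_I smooth_on_funpow_deriv [OF open_I smooth] assms] by simp
  from this [of 0] this [of 1] this [of 2]
  show "(f has_real_derivative f1 s) (at s)" "(f1 has_real_derivative f2 s) (at s)"
    "(f2 has_real_derivative f3 s) (at s)"
    by (simp_all add: numeral_2_eq_2 numeral_3_eq_3)
qed

lemma DERIV_W:
  assumes "s \<in> I"
  shows "(W has_real_derivative f1 s * f2 s / W s) (at s)"
  unfolding W_def [abs_def] using spacelike_normal [OF assms]
  by (auto intro!: derivative_eq_intros DERIV_f [OF assms] simp: field_simps)

lemma DERIV_radial_X: "s \<in> I \<Longrightarrow> (radial_X a has_real_derivative (if a = 1 then f1 s else 1)) (at s)"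
  by (auto simp: radial_X_def [abs_def] intro!: DERIV_f derivative_eq_intros)

lemma DERIV_radial_N:
  assumes "s \<in> I"
  shows "(radial_N a has_real_derivative radial_N' a s) (at s)"
    "(radial_N' a has_real_derivative radial_N'' a s) (at s)"
proof -
  note D = DERIV_f [OF assms] DERIV_W [OF assms]
  have nz: "W s \<noteq> 0" and eq: "(f1 s)\<^sup>2 = (W s)\<^sup>2 + 1"
    using W_pos [OF assms] W_squared [OF assms] by auto
  have "((\<lambda>s. 1 / W s) has_real_derivative - f1 s * f2 s / W s ^ 3) (at s)"
    using nz by (auto intro!: derivative_eq_intros D simp: field_simps eval_nat_numeral)
  moreover have "((\<lambda>s. f1 s / W s) has_real_derivative - f2 s / W s ^ 3) (at s)"
  proof -
    have "((\<lambda>s. f1 s / W s) has_real_derivative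
        (f2 s * W s - f1 s * (f1 s * f2 s / W s)) / (W s * W s)) (at s)"
      by (rule DERIV_divide [OF D(2) D(4) nz])
    \<comment> \<open>Written this way, \<open>W^2 - f'^2 = -1\<close> collapses the numerator to
      \<open>- f''\<close>.\<close>
    moreover have "(f2 s * W s - f1 s * (f1 s * f2 s / W s)) / (W s * W s)
        = f2 s * ((W s)\<^sup>2 - (f1 s)\<^sup>2) / W s ^ 3"
      using nz by (simp add: field_simps eval_nat_numeral)
    ultimately show ?thesis
      by (simp add: eq)
  qed
  ultimately show "(radial_N a has_real_derivative radial_N' a s) (at s)"
    by (auto simp: radial_N_def [abs_def] radial_N'_def [abs_def])
  have p4: "x ^ 4 = x * x * x * x" and p5: "x ^ 5 = x * x * x * x * x"
    and p6: "x ^ 6 = x * x * x * x * x * x" for x :: real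
    by (simp_all add: eval_nat_numeral)
  note powers = power2_eq_square power3_eq_cube p4 p5 p6
  have "((\<lambda>s. - f1 s * f2 s / W s ^ 3) has_real_derivative
      - ((f2 s)\<^sup>2 + f1 s * f3 s) / W s ^ 3 + 3 * (f1 s)\<^sup>2 * (f2 s)\<^sup>2 / W s ^ 5) (at s)"
    using nz by (auto intro!: derivative_eq_intros D simp: field_simps powers)
  moreover have "((\<lambda>s. - f2 s / W s ^ 3) has_real_derivative
      - f3 s / W s ^ 3 + 3 * f1 s * (f2 s)\<^sup>2 / W s ^ 5) (at s)"
    using nz by (auto intro!: derivative_eq_intros D simp: field_simps powers)
  ultimately show "(radial_N' a has_real_derivative radial_N'' a s) (at s)"
    by (auto simp: radial_N'_def [abs_def] radial_N''_def [abs_def])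
qed

section \<open>Differentials, induced metric and shape operator\<close>

lemma hypersurface_nth: "X p $ a = separated (radial_X a) (latitude a) (longitude a) p"
  using exhaust_4 [of a]
  by (auto simp: rot_hypersurface_def Let_def vector_4 separated_def radial_X_def latitude_def longitude_def)

lemma gauss_map_nth: "N p $ a = separated (radial_N a) (latitude a) (longitude a) p"
  using exhaust_4 [of a]
  by (auto simp: rot_gauss_map_def Let_def vector_4 separated_def radial_N_def W_def latitude_def longitude_def)

lemma has_derivative_hypersurface:
  assumes "p \<in> U"
  shows "(X has_derivative (\<lambda>v. (\<chi> a.
      (if a = 1 then f1 (p$1) else 1) * latitude a (p$2) * longitude a (p$3) * v$1
      + radial_X a (p$1) * latitude' a (p$2) * longitude a (p$3) * v$2
      + radial_X a (p$1) * latitude a (p$2) * longitude' a (p$3) * v$3) :: real^4)) (at p)"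
    (is "(_ has_derivative ?D) _")
proof (rule has_derivative_vec_nth)
  fix a
  have "(\<lambda>q. X q $ a) = separated (radial_X a) (latitude a) (longitude a)"
    by (simp add: fun_eq_iff hypersurface_nth)
  then show "((\<lambda>q. X q $ a) has_derivative (\<lambda>v. ?D v $ a)) (at p)"
    using has_derivative_separated [OF DERIV_radial_X DERIV_latitude(1) DERIV_longitude(1),
        OF domainD(1) [OF assms]] by simp
qed

lemma has_derivative_gauss_map:
  assumes "p \<in> U"
  shows "(N has_derivative (\<lambda>v. (\<chi> a.
      radial_N' a (p$1) * latitude a (p$2) * longitude a (p$3) * v$1
      + radial_N a (p$1) * latitude' a (p$2) * longitude a (p$3) * v$2
      + radial_N a (p$1) * latitude a (p$2) * longitude' a (p$3) * v$3) :: real^4)) (at p)"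
    (is "(_ has_derivative ?D) _")
proof (rule has_derivative_vec_nth)
  fix a
  have "(\<lambda>q. N q $ a) = separated (radial_N a) (latitude a) (longitude a)"
    by (simp add: fun_eq_iff gauss_map_nth)
  then show "((\<lambda>q. N q $ a) has_derivative (\<lambda>v. ?D v $ a)) (at p)"
    using has_derivative_separated [OF DERIV_radial_N(1) DERIV_latitude(1) DERIV_longitude(1),
        OF domainD(1) [OF assms]] by simp
qed

lemmas differential_hypersurface = frechet_derivative_at [OF has_derivative_hypersurface, symmetric]
lemmas differential_gauss_map = frechet_derivative_at [OF has_derivative_gauss_map, symmetric]

lemma induced_metric_hypersurface:
  assumes "p \<in> U"
  shows "induced_metric X p = diag (metric p)"
proof -
  have trig: "(sin (p$2))\<^sup>2 = 1 - (cos (p$2))\<^sup>2" "(sin (p$3))\<^sup>2 = 1 - (cos (p$3))\<^sup>2"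
    by (simp_all add: sin_squared_eq)
  show ?thesis
    unfolding induced_metric_def partial_def differential_hypersurface [OF assms] lorentz_def
    using trig
    by (simp add: vec_eq_iff forall_3 diag_def metric_def axis_def radial_X_def
        latitude_def latitude'_def longitude_def longitude'_def, intro conjI) algebra+
qed

lemma metric_nonzero: "p \<in> U \<Longrightarrow> metric p $ i \<noteq> 0"
  using exhaust_3 [of i] domainD [of p] spacelike_normal [of "p$1"] by (auto simp: metric_def)

text \<open>The equations are triangular: component 1 yields \<open>v$1 = 0\<close>, then component
  3 yields \<open>v$2 = 0\<close>, and components 2 and 4 leave \<open>v$3\<close> times the cosine
  and the sine of the same angle. Injectivity gives the uniqueness behind \<open>THE\<close> in
  \<open>shape_operator\<close>.\<close>

lemma differential_hypersurface_inj:
  assumes "p \<in> U" "frechet_derivative X (at p) v = 0"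
  shows "v = 0"
proof -
  note nz = domainD [OF assms(1)]
  have "\<forall>a. frechet_derivative X (at p) v $ a = 0"
    using assms(2) by simp
  note eq = this [unfolded forall_4 differential_hypersurface [OF assms(1)], simplified,
      unfolded radial_X_def latitude_def latitude'_def longitude_def longitude'_def, simplified]
  have "v$1 = 0"
    using eq f1_nonzero [OF nz(1)] by simp
  moreover from this have "v$2 = 0"
    using eq nz by simp
  ultimately have "v$3 * cos (p$3) = 0" "v$3 * sin (p$3) = 0"
    using eq nz by auto
  then have "v$3 = 0"
    using sin_cos_squared_add [of "p$3"] by algebra
  with \<open>v$1 = 0\<close> \<open>v$2 = 0\<close> show ?thesis
    by (simp add: vec_eq_iff forall_3)
qed

lemma shape_operator_hypersurface:
  assumes "p \<in> U"
  shows "shape_operator X N p = diag (vector [k1 (p$1), k2 (p$1), k2 (p$1)])"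
  unfolding shape_operator_def
proof (rule the_equality)
  let ?S = "diag (vector [k1 (p$1), k2 (p$1), k2 (p$1)]) :: real^3^3"
  note nz = domainD [OF assms]
  have "W (p$1) \<noteq> 0"
    using W_pos [OF nz(1)] by simp
  then show S: "\<forall>v. frechet_derivative X (at p) (?S *v v) = - frechet_derivative N (at p) v"
    unfolding differential_hypersurface [OF assms] differential_gauss_map [OF assms]
    using nz by (auto simp: vec_eq_iff forall_4 diag_mult_vec radial_X_def radial_N_def radial_N'_def
        latitude_def latitude'_def longitude_def longitude'_def k1_def k2_def field_simps)
  fix T assume T: "\<forall>v. frechet_derivative X (at p) (T *v v) = - frechet_derivative N (at p) v"
  have "T *v v = ?S *v v" for v
  proof -
    have lin: "linear (frechet_derivative X (at p))"
      using has_derivative_linear has_derivative_hypersurface [OF assms] differential_hypersurface [OF assms]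
      by metis
    have "frechet_derivative X (at p) (T *v v - ?S *v v) = 0"
      using S T by (simp add: linear_diff [OF lin])
    then show ?thesis
      using differential_hypersurface_inj [OF assms] by fastforce
  qed
  then show "T = ?S"
    by (simp add: matrix_eq)
qed


section \<open>The operator \<open>L\<^sub>2\<close> on the Gauss map\<close>

lemma partial_metric:
  assumes "p \<in> U"
  shows "partial 1 (\<lambda>q. metric q $ 1) p = - 2 * f1 (p$1) * f2 (p$1)"
    "partial 2 (\<lambda>q. metric q $ 1) p = 0" "partial 3 (\<lambda>q. metric q $ 1) p = 0"
    "partial 1 (\<lambda>q. metric q $ 2) p = 2 * p$1"
    "partial 2 (\<lambda>q. metric q $ 2) p = 0" "partial 3 (\<lambda>q. metric q $ 2) p = 0"
    "partial 1 (\<lambda>q. metric q $ 3) p = 2 * p$1 * (cos (p$2))\<^sup>2"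
    "partial 2 (\<lambda>q. metric q $ 3) p = - 2 * (p$1)\<^sup>2 * cos (p$2) * sin (p$2)"
    "partial 3 (\<lambda>q. metric q $ 3) p = 0"
proof -
  have m: "(\<lambda>q. metric q $ 1) = separated (\<lambda>s. 1 - (f1 s)\<^sup>2) (\<lambda>_. 1) (\<lambda>_. 1)"
    "(\<lambda>q. metric q $ 2) = separated (\<lambda>s. s\<^sup>2) (\<lambda>_. 1) (\<lambda>_. 1)"
    "(\<lambda>q. metric q $ 3) = separated (\<lambda>s. s\<^sup>2) (\<lambda>t. (cos t)\<^sup>2) (\<lambda>_. 1)"
    by (simp_all add: fun_eq_iff metric_def separated_def)
  have "((\<lambda>s. 1 - (f1 s)\<^sup>2) has_real_derivative - 2 * f1 (p$1) * f2 (p$1)) (at (p$1))"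
    using domainD(1) [OF assms] by (auto intro!: derivative_eq_intros DERIV_f)
  note 1 = partial_separated [OF this DERIV_const DERIV_const]
  have s: "((\<lambda>s. s\<^sup>2) has_real_derivative 2 * p$1) (at (p$1))"
    by (auto intro!: derivative_eq_intros)
  note 2 = partial_separated [OF s DERIV_const DERIV_const]
  have "((\<lambda>t. (cos t)\<^sup>2) has_real_derivative - 2 * cos (p$2) * sin (p$2)) (at (p$2))"
    by (auto intro!: derivative_eq_intros)
  note 3 = partial_separated [OF s this DERIV_const]
  show "partial 1 (\<lambda>q. metric q $ 1) p = - 2 * f1 (p$1) * f2 (p$1)"
    "partial 2 (\<lambda>q. metric q $ 1) p = 0" "partial 3 (\<lambda>q. metric q $ 1) p = 0"
    "partial 1 (\<lambda>q. metric q $ 2) p = 2 * p$1"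
    "partial 2 (\<lambda>q. metric q $ 2) p = 0" "partial 3 (\<lambda>q. metric q $ 2) p = 0"
    "partial 1 (\<lambda>q. metric q $ 3) p = 2 * p$1 * (cos (p$2))\<^sup>2"
    "partial 2 (\<lambda>q. metric q $ 3) p = - 2 * (p$1)\<^sup>2 * cos (p$2) * sin (p$2)"
    "partial 3 (\<lambda>q. metric q $ 3) p = 0"
    unfolding m by (simp_all add: 1 2 3)
qed

text \<open>The second Newton transformation is diagonal with entries \<open>k2^2\<close>,
  \<open>k1 * k2\<close>, \<open>k1 * k2\<close>. The two angular Hessian entries carry equal
  weight, so their sum produces the Laplacian of the unit sphere, scaled by \<open>1 / s^2\<close>,
  and twice a radial term.\<close>

lemma L_op_separated:
  assumes "p \<in> U"
    and A: "\<And>s. s \<in> I \<Longrightarrow> (A has_real_derivative A' s) (at s)"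
      "\<And>s. s \<in> I \<Longrightarrow> (A' has_real_derivative A'' s) (at s)"
    and B: "\<And>t. (B has_real_derivative B' t) (at t)" "\<And>t. (B' has_real_derivative B'' t) (at t)"
    and D: "\<And>w. (D has_real_derivative D' w) (at w)" "\<And>w. (D' has_real_derivative D'' w) (at w)"
  defines "s \<equiv> p$1" and "t \<equiv> p$2" and "w \<equiv> p$3"
  shows "L_op 2 X N (separated A B D) p =
    ((k2 s)\<^sup>2 * (- A'' s / (W s)\<^sup>2 + f1 s * f2 s * A' s / W s ^ 4)
      - 2 * k1 s * k2 s * A' s / (s * (W s)\<^sup>2)) * B t * D w
    + k1 s * k2 s * A s / s\<^sup>2 *
      (B'' t * D w + B t * D'' w / (cos t)\<^sup>2 - sin t / cos t * B' t * D w)"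
proof -
  let ?\<phi> = "separated A B D"
  note p = domainD [OF assms(1)]
  have nz: "s \<noteq> 0" "cos t \<noteq> 0" "W s \<noteq> 0" and sI: "s \<in> I" and W2: "(f1 s)\<^sup>2 = (W s)\<^sup>2 + 1"
    using p W_pos [of s] W_squared [of s] by (auto simp: s_def t_def)
  have grad: "partial 1 ?\<phi> q = A' (q$1) * B (q$2) * D (q$3)"
    "partial 2 ?\<phi> q = A (q$1) * B' (q$2) * D (q$3)"
    "partial 3 ?\<phi> q = A (q$1) * B (q$2) * D' (q$3)" if "q \<in> U" for q
    using partial_separated [OF A(1) B(1) D(1)] domainD(1) [OF that] by blast+
  have met: "metric p $ 1 = - (W s)\<^sup>2" "metric p $ 2 = s\<^sup>2" "metric p $ 3 = s\<^sup>2 * (cos t)\<^sup>2"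
    by (simp_all add: metric_def W2 flip: s_def t_def)
  define H where "H i = hessian_operator (induced_metric X) ?\<phi> p $ i $ i" for i
  have hess: "H i = partial i (\<lambda>q. partial i ?\<phi> q / metric q $ i) p +
      (\<Sum>l\<in>UNIV. partial l (\<lambda>q. metric q $ i) p / (2 * metric p $ i) * (partial l ?\<phi> p / metric p $ l))"
    for i
    unfolding H_def
    by (rule hessian_operator_diag [OF open_domain assms(1) induced_metric_hypersurface metric_nonzero])
  have "partial 1 (\<lambda>q. partial 1 ?\<phi> q / metric q $ 1) p
      = partial 1 (separated (\<lambda>s. A' s / (1 - (f1 s)\<^sup>2)) B D) p"
    by (rule partial_cong_open [OF open_domain assms(1)]) (simp add: grad metric_def separated_def)
  also have "\<dots> = (A'' s / (1 - (f1 s)\<^sup>2) + 2 * f1 s * f2 s * A' s / (1 - (f1 s)\<^sup>2)\<^sup>2) * B t * D w"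
    unfolding s_def t_def w_def
  proof (rule partial_separated(1) [OF _ B(1) D(1)])
    have nz': "1 - (f1 s)\<^sup>2 \<noteq> 0"
      using W2 nz by simp
    have "((\<lambda>s. 1 - (f1 s)\<^sup>2) has_real_derivative - 2 * f1 s * f2 s) (at s)"
      using sI by (auto intro!: derivative_eq_intros DERIV_f)
    from DERIV_divide [OF A(2) [OF sI] this nz']
    show "((\<lambda>s. A' s / (1 - (f1 s)\<^sup>2)) has_real_derivative
        A'' (p$1) / (1 - (f1 (p$1))\<^sup>2) + 2 * f1 (p$1) * f2 (p$1) * A' (p$1) / (1 - (f1 (p$1))\<^sup>2)\<^sup>2) (at (p$1))"
      unfolding s_def [symmetric]
      by (rule DERIV_cong) (use nz' in \<open>simp add: divide_simps power2_eq_square; simp add: algebra_simps\<close>)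
  qed
  also have "1 - (f1 s)\<^sup>2 = - (W s)\<^sup>2"
    by (simp add: W2)
  finally have P1: "partial 1 (\<lambda>q. partial 1 ?\<phi> q / metric q $ 1) p
      = (- A'' s / (W s)\<^sup>2 + 2 * f1 s * f2 s * A' s / W s ^ 4) * B t * D w"
    by (simp flip: power_mult)
  \<comment> \<open>The Christoffel term with \<open>l = 1\<close> subtracts
    \<open>f1 * f2 * A' / W^4\<close>, which halves the second coefficient of
    \<open>P1\<close>.\<close>
  have H1: "H 1 = (- A'' s / (W s)\<^sup>2 + f1 s * f2 s * A' s / W s ^ 4) * B t * D w"
    unfolding hess [of 1] P1 sum_3 met partial_metric [OF assms(1)] grad [OF assms(1)] using nz
    by (simp add: field_simps flip: s_def t_def w_def)
  have "partial 2 (\<lambda>q. partial 2 ?\<phi> q / metric q $ 2) p = partial 2 (separated (\<lambda>s. A s / s\<^sup>2) B' D) p"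
    by (rule partial_cong_open [OF open_domain assms(1)]) (simp add: grad metric_def separated_def)
  also have "\<dots> = A s / s\<^sup>2 * B'' t * D w"
    unfolding s_def t_def w_def using p(1,2)
    by (intro partial_separated(2) [OF DERIV_divide [OF A(1) DERIV_power [OF DERIV_ident]] B(2) D(1)]) auto
  finally have P2: "partial 2 (\<lambda>q. partial 2 ?\<phi> q / metric q $ 2) p = A s / s\<^sup>2 * B'' t * D w" .
  have H2: "H 2 = A s / s\<^sup>2 * B'' t * D w - A' s * B t * D w / (s * (W s)\<^sup>2)"
    unfolding hess [of 2] P2 sum_3 met partial_metric [OF assms(1)] grad [OF assms(1)] using nz
    by (simp add: field_simps power2_eq_square flip: s_def t_def w_def)
  have "partial 3 (\<lambda>q. partial 3 ?\<phi> q / metric q $ 3) p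
      = partial 3 (separated (\<lambda>s. A s / s\<^sup>2) (\<lambda>t. B t / (cos t)\<^sup>2) D') p"
    by (rule partial_cong_open [OF open_domain assms(1)]) (simp add: grad metric_def separated_def)
  also have "\<dots> = A s / s\<^sup>2 * (B t / (cos t)\<^sup>2) * D'' w"
    unfolding s_def t_def w_def using p
    by (intro partial_separated(3) [OF DERIV_divide [OF A(1) DERIV_power [OF DERIV_ident]]
          DERIV_divide [OF B(1) DERIV_power [OF DERIV_cos]] D(2)]) auto
  finally have P3: "partial 3 (\<lambda>q. partial 3 ?\<phi> q / metric q $ 3) p
      = A s / s\<^sup>2 * (B t / (cos t)\<^sup>2) * D'' w" .
  \<comment> \<open>Here the term with \<open>l = 2\<close> also contributes, because the third
    metric coefficient depends on \<open>t\<close>; it gives the first-order part of the spherical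
    Laplacian.\<close>
  have H3: "H 3 = A s / s\<^sup>2 * (B t / (cos t)\<^sup>2) * D'' w - A' s * B t * D w / (s * (W s)\<^sup>2)
      - sin t / cos t * (A s / s\<^sup>2) * B' t * D w"
    unfolding hess [of 3] P3 sum_3 met partial_metric [OF assms(1)] grad [OF assms(1)] using nz
    by (simp add: field_simps power2_eq_square flip: s_def t_def w_def)
  have "L_op 2 X N ?\<phi> p = (k2 s)\<^sup>2 * H 1 + k1 s * k2 s * (H 2 + H 3)"
    by (simp add: L_op_def shape_operator_hypersurface [OF assms(1)] newton_transformation_2_diag
        trace_diag_mult sum_3 H_def s_def power2_eq_square algebra_simps)
  then show ?thesis
    unfolding H1 H2 H3 using nz by (simp add: algebra_simps add_divide_distrib diff_divide_distrib)
qed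

text \<open>The factor \<open>\<mu>\<close> is read off the spatial components of \<open>L\<^sub>2 N = \<mu> (N + C)\<close>, where
  \<open>C\<close> does not contribute; the equation for the remaining component is then the differential equation.\<close>

definition \<mu> :: "real \<Rightarrow> real" where
  "\<mu> s = (2 * (f1 s * ((f1 s)\<^sup>2 - 1)\<^sup>2 - s * (2 * (f1 s)\<^sup>2 + 1) * f2 s) * f2 s
      + s * ((f1 s)\<^sup>2 - 1) * f1 s * f3 s) * inverse (s ^ 3 * ((f1 s)\<^sup>2 - 1) ^ 4)"

section \<open>Components of the operator on the Gauss map and the differential equation\<close>

lemma smooth_\<mu>: "smooth_on U (\<lambda>p. \<mu> (p$1))"
  unfolding smooth_on_def
proof
  fix k
  have c: "Ck_on k I f1" "Ck_on k I f2" "Ck_on k I f3"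
    using smooth_on_funpow_deriv [OF open_I smooth, of 1] smooth_on_funpow_deriv [OF open_I smooth]
    by (simp_all add: smooth_on_def)
  have "(f1 s)\<^sup>2 - 1 \<noteq> 0" "s \<noteq> 0" if "s \<in> I" for s
    using spacelike_normal [OF that] zero_notin that by auto
  then have "Ck_on k I \<mu>"
    unfolding \<mu>_def [abs_def]
    by (intro Ck_on_mult Ck_on_add Ck_on_diff Ck_on_power Ck_on_inverse Ck_on_const Ck_on_ident open_I c)
      simp_all
  then show "Ck_on k U (\<lambda>p. \<mu> (p$1))"
    using Ck_on_compose_nth [OF open_domain, of 1 I k \<mu>] domainD(1) by blast
qed

text \<open>For \<open>a = 1\<close> the spherical Laplacian vanishes and only radial terms remain.
  For the other three components the radial function and the eigenvalue -2 are the same, so one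
  factor depending on \<open>s\<close> alone serves all of them.\<close>

lemma L_op_gauss_map:
  assumes "p \<in> U"
  defines "s \<equiv> p$1"
  shows "L_op 2 X N (\<lambda>q. N q $ a) p = (if a = 1
      then (f1 s)\<^sup>2 * (((f1 s)\<^sup>2 - 1) * f1 s * f3 s - 3 * ((f1 s)\<^sup>2 + 1) * (f2 s)\<^sup>2) / (s\<^sup>2 * W s ^ 9)
      else \<mu> s * N p $ a)"
proof -
  let ?t = "p$2" and ?w = "p$3"
  have sI: "s \<in> I" and nz: "s \<noteq> 0" "cos ?t \<noteq> 0" "W s \<noteq> 0" and q: "(f1 s)\<^sup>2 - 1 = (W s)\<^sup>2"
    using domainD [OF assms(1)] W_pos [of s] W_squared [of s] by (auto simp: s_def)
  have "(\<lambda>q. N q $ a) = separated (radial_N a) (latitude a) (longitude a)"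
    by (simp add: fun_eq_iff gauss_map_nth)
  then have "L_op 2 X N (\<lambda>q. N q $ a) p =
      ((k2 s)\<^sup>2 * (- radial_N'' a s / (W s)\<^sup>2 + f1 s * f2 s * radial_N' a s / W s ^ 4)
        - 2 * k1 s * k2 s * radial_N' a s / (s * (W s)\<^sup>2)) * latitude a ?t * longitude a ?w
      + k1 s * k2 s * radial_N a s / s\<^sup>2 * (if a = 1 then 0 else - 2 * latitude a ?t * longitude a ?w)"
    by (simp only: L_op_separated [OF assms(1) DERIV_radial_N DERIV_latitude DERIV_longitude]
        latitude_longitude_laplacian [OF nz(2)] s_def [symmetric])
  also have "\<dots> = (if a = 1
      then (f1 s)\<^sup>2 * ((W s)\<^sup>2 * f1 s * f3 s - 3 * ((f1 s)\<^sup>2 + 1) * (f2 s)\<^sup>2) / (s\<^sup>2 * W s ^ 9)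
      else \<mu> s * N p $ a)"
  proof (cases "a = 1")
    case True
    have "(- f1 s / (s * W s))\<^sup>2 * (- (- ((f2 s)\<^sup>2 + f1 s * f3 s) / W s ^ 3
          + 3 * (f1 s)\<^sup>2 * (f2 s)\<^sup>2 / W s ^ 5) / (W s)\<^sup>2
          + f1 s * f2 s * (- f1 s * f2 s / W s ^ 3) / W s ^ 4)
        - 2 * (f2 s / W s ^ 3) * (- f1 s / (s * W s)) * (- f1 s * f2 s / W s ^ 3) / (s * (W s)\<^sup>2)
      = (f1 s)\<^sup>2 * ((W s)\<^sup>2 * ((f2 s)\<^sup>2 + f1 s * f3 s) - 4 * (f1 s)\<^sup>2 * (f2 s)\<^sup>2 - 2 * (f2 s)\<^sup>2) / (s\<^sup>2 * W s ^ 9)"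
      using nz by (simp add: divide_simps) algebra
    \<comment> \<open>The coefficient of \<open>f2^2\<close> is \<open>W^2 - 4 * f1^2 - 2\<close>,
      which equals \<open>-3 * (f1^2 + 1)\<close>.\<close>
    also have "(W s)\<^sup>2 * ((f2 s)\<^sup>2 + f1 s * f3 s) - 4 * (f1 s)\<^sup>2 * (f2 s)\<^sup>2 - 2 * (f2 s)\<^sup>2
        = (W s)\<^sup>2 * f1 s * f3 s - 3 * ((f1 s)\<^sup>2 + 1) * (f2 s)\<^sup>2"
      using q by algebra
    finally show ?thesis
      using True by (simp add: radial_N'_def radial_N''_def k1_def k2_def latitude_def longitude_def)
  next
    case False
    \<comment> \<open>Every summand contains \<open>f1\<close>, so the radial factor
      \<open>f1 / W\<close> of the Gauss map splits off.\<close>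
    have "(- f1 s / (s * W s))\<^sup>2 * (- (- f3 s / W s ^ 3 + 3 * f1 s * (f2 s)\<^sup>2 / W s ^ 5) / (W s)\<^sup>2
          + f1 s * f2 s * (- f2 s / W s ^ 3) / W s ^ 4)
        - 2 * (f2 s / W s ^ 3) * (- f1 s / (s * W s)) * (- f2 s / W s ^ 3) / (s * (W s)\<^sup>2)
        - 2 * (f2 s / W s ^ 3) * (- f1 s / (s * W s)) * (f1 s / W s) / s\<^sup>2
      = (f1 s * f3 s * s * (W s)\<^sup>2 - 4 * s * (f1 s)\<^sup>2 * (f2 s)\<^sup>2 - 2 * s * (f2 s)\<^sup>2
          + 2 * f2 s * f1 s * W s ^ 4) / (s ^ 3 * W s ^ 8) * (f1 s / W s)"
      using nz by (simp add: divide_simps) algebra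
    also have "\<dots> = \<mu> s * (f1 s / W s)"
      unfolding \<mu>_def q using nz by (simp add: divide_simps) algebra
    finally have "(k2 s)\<^sup>2 * (- radial_N'' a s / (W s)\<^sup>2 + f1 s * f2 s * radial_N' a s / W s ^ 4)
        - 2 * k1 s * k2 s * radial_N' a s / (s * (W s)\<^sup>2) - 2 * k1 s * k2 s * radial_N a s / s\<^sup>2
      = \<mu> s * radial_N a s"
      using False by (simp only: radial_N_def radial_N'_def radial_N''_def k1_def k2_def if_False)
    from arg_cong [OF this, of "\<lambda>z. z * (latitude a ?t * longitude a ?w)"] False
    show ?thesis
      by (simp add: gauss_map_nth separated_def s_def [symmetric] algebra_simps)
  qed
  finally show ?thesis
    by (simp add: q)
qed

lemma L_vec_gauss_map:
  assumes "p \<in> U"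
    and ode: "let f' = f1 (p$1); f'' = f2 (p$1); f''' = f3 (p$1); s = p$1 in
      (1 + C1 * sqrt (f'\<^sup>2 - 1)) *
        (2 * (f' * (f'\<^sup>2 - 1)\<^sup>2 - s * (2 * f'\<^sup>2 + 1) * f'') * f'' + s * (f'\<^sup>2 - 1) * f' * f''')
      - s * f'\<^sup>2 * ((f'\<^sup>2 - 1) * f' * f''' - 3 * (f'\<^sup>2 + 1) * f''\<^sup>2) = 0"
  shows "L_vec 2 X N N p = \<mu> (p$1) *\<^sub>R (N p + vector [C1, 0, 0, 0])"
proof -
  define s where "s = p$1"
  have nz: "s \<noteq> 0" "W s \<noteq> 0" and q: "(f1 s)\<^sup>2 - 1 = (W s)\<^sup>2"
    using domainD [OF assms(1)] W_pos [of s] W_squared [of s] by (auto simp: s_def)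
  define T where "T = ((f1 s)\<^sup>2 - 1) * f1 s * f3 s - 3 * ((f1 s)\<^sup>2 + 1) * (f2 s)\<^sup>2"
  define M where "M = 2 * (f1 s * ((f1 s)\<^sup>2 - 1)\<^sup>2 - s * (2 * (f1 s)\<^sup>2 + 1) * f2 s) * f2 s
      + s * ((f1 s)\<^sup>2 - 1) * f1 s * f3 s"
  have \<mu>: "\<mu> s = M / (s ^ 3 * W s ^ 8)"
    unfolding \<mu>_def M_def q by (simp add: divide_inverse flip: power_mult)
  \<comment> \<open>This is the differential equation in the abbreviations \<open>M\<close> and
    \<open>T\<close>. Dividing by \<open>s^3 * W^9\<close> turns it into the identity for the first
    component.\<close>
  have "(1 + C1 * W s) * M = s * (f1 s)\<^sup>2 * T"
    using ode by (simp add: Let_def W_def T_def M_def flip: s_def)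
  then have "\<mu> s * (1 / W s + C1) = s * (f1 s)\<^sup>2 * T / (s ^ 3 * W s ^ 9)"
    unfolding \<mu> using nz by (simp add: divide_simps) algebra
  also have "\<dots> = (f1 s)\<^sup>2 * T / (s\<^sup>2 * W s ^ 9)"
    using nz by (simp add: divide_simps power2_eq_square power3_eq_cube)
  finally have first: "L_op 2 X N (\<lambda>q. N q $ 1) p = \<mu> s * (1 / W s + C1)"
    by (simp add: L_op_gauss_map [OF assms(1)] T_def flip: s_def)
  have "N p $ 1 = 1 / W s"
    by (simp add: gauss_map_nth separated_def radial_N_def latitude_def longitude_def s_def)
  with first have "L_op 2 X N (\<lambda>q. N q $ a) p = \<mu> s * (N p $ a + vector [C1, 0, 0, 0] $ a)" for a
    using exhaust_4 [of a] L_op_gauss_map [OF assms(1), of a] by (auto simp: vector_4 s_def)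
  then show ?thesis
    by (simp add: vec_eq_iff L_vec_def s_def)
qed

text \<open>The last three components of \<open>X p\<close> have Euclidean norm equal to the
  absolute value of \<open>p$1\<close>. Opposite values of the parameter would force the interval
  \<open>I\<close> to contain 0. The angles are not recovered, but a function of \<open>s\<close>
  alone still descends to the point set.\<close>

lemma hypersurface_radius_inj:
  assumes "is_interval I" "p \<in> U" "q \<in> U" "X p = X q"
  shows "p$1 = q$1"
proof -
  have sph: "(X r $ 2)\<^sup>2 + (X r $ 3)\<^sup>2 + (X r $ 4)\<^sup>2 = (r$1)\<^sup>2" for r
    by (simp add: rot_hypersurface_def Let_def vector_4 power_mult_distrib sin_squared_eq algebra_simps)
  have "(p$1)\<^sup>2 = (q$1)\<^sup>2"
    using sph [of p] sph [of q] assms(4) by simp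
  then consider "p$1 = q$1" | "p$1 = - q$1"
    by (auto simp: power2_eq_iff)
  then show ?thesis
  proof cases
    case 2
    note pI = domainD(1) [OF assms(2)] and qI = domainD(1) [OF assms(3)]
    have "0 \<in> I"
    proof (cases "p$1 \<le> 0")
      case True
      with 2 show ?thesis
        by (intro mem_is_interval_1_I [OF assms(1) pI qI]) simp_all
    next
      case False
      with 2 show ?thesis
        by (intro mem_is_interval_1_I [OF assms(1) qI pI]) simp_all
    qed
    with zero_notin show ?thesis by simp
  qed simp
qed

end

theorem theorem16:
  fixes I :: "real set" and f :: "real \<Rightarrow> real" and C1 :: real
  assumes "open I" and "is_interval I" and "0 \<notin> I"
    and "smooth_on I f"
    and "\<forall>s\<in>I. (deriv f s)\<^sup>2 > 1"
    and "\<forall>s\<in>I. (deriv ^^ 2) f s \<noteq> 0"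
    and "C1 \<noteq> 0"
    and "\<exists>p \<in> rot_domain I.
           L_vec 2 (rot_hypersurface f) (rot_gauss_map f) (rot_gauss_map f) p \<noteq> 0"
    and "\<forall>s\<in>I. let f' = deriv f s; f'' = (deriv ^^ 2) f s; f''' = (deriv ^^ 3) f s in
           (1 + C1 * sqrt (f'\<^sup>2 - 1)) *
             (2 * (f' * (f'\<^sup>2 - 1)\<^sup>2 - s * (2 * f'\<^sup>2 + 1) * f'') * f''
                + s * (f'\<^sup>2 - 1) * f' * f''')
           - s * f'\<^sup>2 * ((f'\<^sup>2 - 1) * f' * f''' - 3 * (f'\<^sup>2 + 1) * f''\<^sup>2) = 0"
  shows "second_kind_L_pointwise_1_type 2 (rot_domain I) (rot_hypersurface f) (rot_gauss_map f)
    \<and> second_kind_L_pointwise_1_type_with 2 (rot_domain I) (rot_hypersurface f) (rot_gauss_map f)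
           (vector [C1, 0, 0, 0])"
proof -
  interpret rotational_profile I f
    using assms by unfold_locales auto
  \<comment> \<open>Any preimage of \<open>x\<close> in \<open>U\<close> may be used, because all of
    them share the first parameter.\<close>
  define m where "m x = \<mu> (inv_into U X x $ 1)" for x
  have m: "m (X p) = \<mu> (p$1)" if "p \<in> U" for p
    unfolding m_def
    using hypersurface_radius_inj [OF assms(2) inv_into_into that] f_inv_into_f [of "X p" X U] that
    by (metis image_eqI)
  have smooth: "smooth_on U (m \<circ> X)"
    using smooth_\<mu> Ck_on_cong [OF open_domain, of "\<lambda>p. \<mu> (p$1)" "m \<circ> X"] m
    by (auto simp: smooth_on_def)
  have L: "L_vec 2 X N N p = m (X p) *\<^sub>R (N p + vector [C1, 0, 0, 0])" if "p \<in> U" for p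
    using L_vec_gauss_map [OF that, of C1] assms(9) domainD(1) [OF that] m [OF that]
    by (simp add: Let_def)
  \<comment> \<open>At a parameter where \<open>L_vec\<close> does not vanish, \<open>L\<close>
    rules out a zero factor.\<close>
  have "\<exists>x \<in> X ` U. m x \<noteq> 0"
    using assms(8) L by (metis image_eqI scaleR_zero_left)
  moreover have "(vector [C1, 0, 0, 0] :: real^4) \<noteq> 0"
    using assms(7) vector_4(1) [of C1 0 0 0] by (metis zero_index)
  ultimately have "second_kind_L_pointwise_1_type_with 2 U X N (vector [C1, 0, 0, 0])"
    unfolding second_kind_L_pointwise_1_type_with_def using smooth L by blast
  then show ?thesis
    unfolding second_kind_L_pointwise_1_type_def by blast
qed

end
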